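(* Let $d\ge0$ and suppose $\underline V\in\mathbb{R}[x]_d$ is such that, for some $p=(p_1,\dots,p_m)\in\mathbb{R}[x]_d^m$, the following constraints hold: - $l_x-\beta\underline V+\nabla\underline V\cdot f+\bar u\sum_{i=1}^mp_i\in Q_d(X)$; - $l_{u_i}+\nabla\underline V\cdot f_{u_i}-p_i\in Q_d(X)$, $i=1,\dots,m$; - $-p_i\in Q_d(X)$, $i=1,\dots,m$; - $M-\underline V\in Q_d(X)+\bar g\,\mathbb{R}[x]_{d-\deg\bar g}$. Then $\underline V\le V$ on $X$, where $V$ is the value function of the optimal control problem defined in the context.
   Context: **Setting.** Let $f, f_{u_1},\dots,f_{u_m}\in\mathbb{R}[x]^n$ (polynomial vector fields on $\mathbb{R}^n$), and consider the controlled system $$\dot x(t) = f(x(t))+\sum_{i=1}^m f_{u_i}(x(t))u_i(t).$$ Let $X=\{x\in\mathbb{R}^n : g_i(x)\ge 0,\ i=1,\dots,n_g\}$ with $g_i\in\mathbb{R}[x]$, and $U=[0,\bar u]^m$ with $\bar u\ge 0$. $X$ is compact, one of the inequalities $g_i\ge 0$ is $N-\|x\|^2\ge 0$ for some $N\ge 0$, and $\bar g(x):=\prod_{i=1}^{n_g}g_i(x)>0$ for all $x$ in the interior $X^\circ$. Let $\beta>0$, let $l_x,l_{u_1},\dots,l_{u_m}\in\mathbb{R}[x]$ be such that $l(x,u):=l_x(x)+\sum_{i=1}^m l_{u_i}(x)u_i\ge 0$ on $X\times U$, and let $M>\beta^{-1}\sup_{x\in X,u\in U} l(x,u)$. $L(X;Y)$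 denotes the Lebesgue measurable functions $X\to Y$. **Optimal control problem (OCP).** For $x_0\in X$, $$V(x_0):=\inf \int_0^{\tau(x_0)}e^{-\beta t}\Big[l_x(x(t))+\sum_{i=1}^m l_{u_i}(x(t))u_i(t)\Big]dt+e^{-\beta\tau(x_0)}M,$$ the infimum being over $u\in L^\infty([0,\tau(x_0)];U)$ and stopping functions $\tau\in L(X;[0,\infty])$ such that the solution $x(\cdot)$ of the system with $x(0)=x_0$ satisfies $x(t)\in X$ for all $t\in[0,\tau(x_0)]$ (with $e^{-\beta\cdot\infty}=0$). **Quadratic modules.** $\Sigma_{2k}$ is the set of polynomial sums of squares of degree at most $2k$; $\mathbb{R}[x]_d$ is the space of polynomials of degree at most $d$. The truncated quadratic module is $$Q_d(X)=\Big\{s_0+\sum_{i=1}^{n_g}g_is_i : s_0\in\Sigma_{2\lfloor d/2\rfloor},\ s_i\in\Sigma_{2\lfloor (d-\deg g_i)/2\rfloor}\Big\}.$$ Sets of polynomials of negative degree bound are $\{0\}$. Sums and products of sets are elementwise. *)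

theory Defs
  imports
    "HOL-Analysis.Analysis"
    "HOL-Library.Poly_Mapping"
    "HOL-Library.Set_Algebras"
begin

section \<open>Real polynomials in the variables \<open>x $ j\<close>, \<open>j :: 'n\<close>\<close>

text \<open>
  A polynomial maps each monomial, given by its exponents, to its coefficient. Addition and
  multiplication (convolution) are those of \<open>Poly_Mapping\<close>.
\<close>

type_synonym 'n rpoly = "('n \<Rightarrow>\<^sub>0 nat) \<Rightarrow>\<^sub>0 real"

definition pconst :: "real \<Rightarrow> 'n rpoly" where
  "pconst c = Poly_Mapping.single 0 c"

definition peval :: "'n::finite rpoly \<Rightarrow> real^'n \<Rightarrow> real" where
  "peval p x = (\<Sum>a\<in>Poly_Mapping.keys p.
     Poly_Mapping.lookup p a * (\<Prod>j\<in>UNIV. (x $ j) ^ Poly_Mapping.lookup a j))"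

text \<open>
  Truncated subtraction of exponents is harmless below: a monomial without the variable \<open>j\<close> gets
  the coefficient 0.
\<close>

definition pdiff :: "'n \<Rightarrow> 'n rpoly \<Rightarrow> 'n rpoly" where
  "pdiff j p = (\<Sum>a\<in>Poly_Mapping.keys p.
     Poly_Mapping.single (a - Poly_Mapping.single j 1)
       (real (Poly_Mapping.lookup a j) * Poly_Mapping.lookup p a))"

definition grad_dot :: "'n::finite rpoly \<Rightarrow> ('n \<Rightarrow> 'n rpoly) \<Rightarrow> 'n rpoly" where
  "grad_dot p F = (\<Sum>j\<in>UNIV. pdiff j p * F j)"

definition mono_deg :: "('n::finite \<Rightarrow>\<^sub>0 nat) \<Rightarrow> nat" where
  "mono_deg a = (\<Sum>j\<in>UNIV. Poly_Mapping.lookup a j)"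

definition total_deg :: "'n::finite rpoly \<Rightarrow> nat" where
  "total_deg p = Max (insert 0 (mono_deg ` Poly_Mapping.keys p))"

text \<open>
  Degree bounds are integers, since the bounds \<open>d - deg g\<^sub>i\<close> may be negative; for a negative
  bound both of the following sets are \<open>{0}\<close>.
\<close>

definition polys_le :: "int \<Rightarrow> 'n::finite rpoly set" where
  "polys_le d = {p. \<forall>a\<in>Poly_Mapping.keys p. int (mono_deg a) \<le> d}"

definition sos_le :: "int \<Rightarrow> 'n::finite rpoly set" where
  "sos_le d = {s \<in> polys_le d. \<exists>qs. s = (\<Sum>q\<leftarrow>qs. q\<^sup>2)}"

definition semialg_set :: "nat \<Rightarrow> (nat \<Rightarrow> 'n::finite rpoly) \<Rightarrow> (real^'n) set" where
  "semialg_set ng g = {x. \<forall>i\<in>{1..ng}. 0 \<le> peval (g i) x}"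

text \<open>Here \<open>div\<close> on integers rounds towards minus infinity, i.e. it is the floor of the quotient.\<close>

definition quad_module :: "nat \<Rightarrow> (nat \<Rightarrow> 'n::finite rpoly) \<Rightarrow> int \<Rightarrow> 'n rpoly set" where
  "quad_module ng g d = {s0 + (\<Sum>i=1..ng. g i * s i) | s0 s.
     s0 \<in> sos_le (2 * (d div 2)) \<and>
     (\<forall>i\<in>{1..ng}. s i \<in> sos_le (2 * ((d - int (total_deg (g i))) div 2)))}"


section \<open>The discounted optimal control problem\<close>

definition control_box :: "real \<Rightarrow> (real^'m) set" where
  "control_box ub = {u. \<forall>i. 0 \<le> u $ i \<and> u $ i \<le> ub}"

definition dynamics ::
  "('n::finite \<Rightarrow> 'n rpoly) \<Rightarrow> ('m::finite \<Rightarrow> 'n \<Rightarrow> 'n rpoly) \<Rightarrow> real^'n \<Rightarrow> real^'m \<Rightarrow> real^'n" where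
  "dynamics f fu x u = (\<chi> j. peval (f j) x + (\<Sum>i\<in>UNIV. peval (fu i j) x * u $ i))"

definition stage_cost ::
  "'n::finite rpoly \<Rightarrow> ('m::finite \<Rightarrow> 'n rpoly) \<Rightarrow> real^'n \<Rightarrow> real^'m \<Rightarrow> real" where
  "stage_cost lx lu x u = peval lx x + (\<Sum>i\<in>UNIV. peval (lu i) x * u $ i)"

text \<open>The closed interval from 0 to \<open>T\<close>, where \<open>T = \<infinity>\<close> gives the whole half-line.\<close>

definition horizon :: "ennreal \<Rightarrow> real set" where
  "horizon T = {t. 0 \<le> t \<and> ennreal t \<le> T}"

text \<open>
  \<open>L\<^sup>\<infinity>(I; U)\<close> for bounded \<open>U\<close>, where essential boundedness is automatic; members are
  represented by functions, whose values matter only almost everywhere on \<open>I\<close>.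
\<close>

definition controls :: "(real^'m) set \<Rightarrow> real set \<Rightarrow> (real \<Rightarrow> real^'m) set" where
  "controls U I = {u \<in> borel_measurable (lebesgue_on I). AE t in lebesgue_on I. u t \<in> U}"

text \<open>
  Solutions for measurable controls are Caratheodory solutions, i.e. they satisfy the integral
  form of the differential equation (with Lebesgue integrals).
\<close>

definition solution ::
  "('n::finite \<Rightarrow> 'n rpoly) \<Rightarrow> ('m::finite \<Rightarrow> 'n \<Rightarrow> 'n rpoly) \<Rightarrow> real^'n \<Rightarrow> real set \<Rightarrow>
   (real \<Rightarrow> real^'m) \<Rightarrow> (real \<Rightarrow> real^'n) \<Rightarrow> bool" where
  "solution f fu x0 I u x \<longleftrightarrow>
     (\<forall>t\<in>I. set_integrable lebesgue {0..t} (\<lambda>s. dynamics f fu (x s) (u s)) \<and>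
            x t = x0 + (LINT s:{0..t}|lebesgue. dynamics f fu (x s) (u s)))"

definition discount :: "real \<Rightarrow> ennreal \<Rightarrow> real" where
  "discount \<beta> T = (if T = \<infinity> then 0 else exp (- \<beta> * enn2real T))"

definition admissible ::
  "('n::finite \<Rightarrow> 'n rpoly) \<Rightarrow> ('m::finite \<Rightarrow> 'n \<Rightarrow> 'n rpoly) \<Rightarrow> (real^'n) set \<Rightarrow> (real^'m) set \<Rightarrow>
   real^'n \<Rightarrow> (real^'n \<Rightarrow> ennreal) \<Rightarrow> (real \<Rightarrow> real^'m) \<Rightarrow> (real \<Rightarrow> real^'n) \<Rightarrow> bool" where
  "admissible f fu X U x0 \<tau> u x \<longleftrightarrow>
     \<tau> \<in> borel_measurable (lebesgue_on X) \<and>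
     u \<in> controls U (horizon (\<tau> x0)) \<and>
     solution f fu x0 (horizon (\<tau> x0)) u x \<and>
     (\<forall>t\<in>horizon (\<tau> x0). x t \<in> X)"

definition total_cost ::
  "'n::finite rpoly \<Rightarrow> ('m::finite \<Rightarrow> 'n rpoly) \<Rightarrow> real \<Rightarrow> real \<Rightarrow> ennreal \<Rightarrow>
   (real \<Rightarrow> real^'m) \<Rightarrow> (real \<Rightarrow> real^'n) \<Rightarrow> real" where
  "total_cost lx lu \<beta> M T u x =
     (LINT t:horizon T|lebesgue. exp (- \<beta> * t) * stage_cost lx lu (x t) (u t))
     + discount \<beta> T * M"

text \<open>
  The solution for a given control is unique, so the infimum may range over the solution as well.
  The infimum is a genuine one in the intended setting: for \<open>x0 \<in> X\<close>, \<open>\<tau> = 0\<close> is admissible, and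
  costs are nonnegative.
\<close>

definition value_function ::
  "('n::finite \<Rightarrow> 'n rpoly) \<Rightarrow> ('m::finite \<Rightarrow> 'n \<Rightarrow> 'n rpoly) \<Rightarrow> (real^'n) set \<Rightarrow> (real^'m) set \<Rightarrow>
   'n rpoly \<Rightarrow> ('m \<Rightarrow> 'n rpoly) \<Rightarrow> real \<Rightarrow> real \<Rightarrow> real^'n \<Rightarrow> real" where
  "value_function f fu X U lx lu \<beta> M x0 =
     Inf {total_cost lx lu \<beta> M (\<tau> x0) u x | \<tau> u x. admissible f fu X U x0 \<tau> u x}"

end

theory Submission
  imports Defs
begin

text \<open>
  The first three certificates make the Hamiltonian \<open>l(x,u) - \<beta> V + \<nabla>V \<cdot> (f + \<Sum>i. u\<^sub>i f\<^sub>u\<^sub>i)\<close> nonnegative on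
  \<open>X \<times> U\<close>, so \<open>exp (- \<beta> t) V(x(t))\<close> decreases along a trajectory by at most the discounted running
  cost. It remains to see that \<open>V \<le> M\<close> at the stopping point. On the boundary of \<open>X\<close> this holds because
  the product of the \<open>g\<^sub>i\<close> vanishes there. At an interior maximum of \<open>V\<close> the gradient vanishes, and the
  first certificate with \<open>p\<^sub>i \<le> 0\<close> gives \<open>\<beta> V \<le> l(x,0) < \<beta> M\<close>; hence \<open>V \<le> M\<close> on all of \<open>X\<close>.

  Trajectories are only Lipschitz. The chain rule along them avoids almost everywhere
  differentiation: with \<open>x' = y\<close>, the function \<open>t \<mapsto> V(x(t)) - \<integral>\<^sub>0\<^sup>t \<nabla>V(x(s)) \<cdot> y(s) ds\<close> has derivative 0
  at every \<open>t\<close>, since \<open>s \<mapsto> (\<nabla>V(x(t)) - \<nabla>V(x(s))) \<cdot> y(s)\<close> is continuous at \<open>s = t\<close> although \<open>y\<close> need not be.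
\<close>

section \<open>Evaluation and differentiation of polynomials\<close>

text \<open>Lets polynomials with different supports be summed over one common set of
  monomials.\<close>

lemma peval_superset:
  assumes "finite A" "Poly_Mapping.keys p \<subseteq> A"
  shows "peval p x = (\<Sum>a\<in>A. Poly_Mapping.lookup p a * (\<Prod>j\<in>UNIV. (x $ j) ^ Poly_Mapping.lookup a j))"
  unfolding peval_def
  by (rule sum.mono_neutral_left) (use assms in \<open>auto simp: in_keys_iff\<close>)

lemma peval_zero [simp]: "peval 0 x = 0"
  by (simp add: peval_def)

lemma peval_single:
  "peval (Poly_Mapping.single a c) x = c * (\<Prod>j\<in>UNIV. (x $ j) ^ Poly_Mapping.lookup a j)"
  by (subst peval_superset[of "{a}"]) auto

lemma peval_pconst [simp]: "peval (pconst c) x = c"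
  by (simp add: pconst_def peval_single)

lemma peval_one [simp]: "peval 1 x = 1"
  using peval_pconst[of 1 x] by (simp add: pconst_def)

lemma peval_add [simp]: "peval (p + q) x = peval p x + peval q x"
proof -
  let ?A = "Poly_Mapping.keys p \<union> Poly_Mapping.keys q"
  have "Poly_Mapping.keys (p + q) \<subseteq> ?A"
    by (rule keys_add)
  then show ?thesis
    by (simp add: peval_superset[of ?A] lookup_add algebra_simps sum.distrib)
qed

lemma peval_uminus [simp]: "peval (- p) x = - peval p x"
  using peval_add[of p "- p" x] by simp

lemma peval_diff [simp]: "peval (p - q) x = peval p x - peval q x"
  using peval_add[of p "- q" x] by simp

lemma peval_sum [simp]: "peval (\<Sum>i\<in>I. q i) x = (\<Sum>i\<in>I. peval (q i) x)"
  by (induction I rule: infinite_finite_induct) auto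

lemma poly_mapping_sum_single:
  "(\<Sum>a\<in>Poly_Mapping.keys p. Poly_Mapping.single a (Poly_Mapping.lookup p a)) = p"
  by (rule poly_mapping_eqI)
    (simp add: lookup_sum lookup_single when_def in_keys_iff)

text \<open>By bilinearity it suffices to multiply single monomials, where exponents add.\<close>

lemma peval_mult [simp]: "peval (p * q) x = peval p x * peval q x"
proof -
  have s: "peval (Poly_Mapping.single a c * Poly_Mapping.single b e) x
      = peval (Poly_Mapping.single a c) x * peval (Poly_Mapping.single b e) x" for a b c e
    by (simp add: mult_single peval_single lookup_add power_add prod.distrib)
  have "p * q = (\<Sum>a\<in>Poly_Mapping.keys p. Poly_Mapping.single a (Poly_Mapping.lookup p a))
      * (\<Sum>b\<in>Poly_Mapping.keys q. Poly_Mapping.single b (Poly_Mapping.lookup q b))"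
    by (simp only: poly_mapping_sum_single)
  also have "peval \<dots> x =
      peval (\<Sum>a\<in>Poly_Mapping.keys p. Poly_Mapping.single a (Poly_Mapping.lookup p a)) x
      * peval (\<Sum>b\<in>Poly_Mapping.keys q. Poly_Mapping.single b (Poly_Mapping.lookup q b)) x"
    by (simp add: sum_product s)
  finally show ?thesis
    by (simp only: poly_mapping_sum_single)
qed

lemma peval_prod [simp]: "peval (\<Prod>i\<in>I. q i) x = (\<Prod>i\<in>I. peval (q i) x)"
  by (induction I rule: infinite_finite_induct) auto

lemma continuous_on_peval [continuous_intros]:
  "continuous_on S h \<Longrightarrow> continuous_on S (\<lambda>t. peval p (h t))"
  unfolding peval_def by (intro continuous_intros)

definition pgrad :: "'n::finite rpoly \<Rightarrow> real^'n \<Rightarrow> real^'n" where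
  "pgrad p x = (\<chi> j. peval (pdiff j p) x)"

lemma peval_grad_dot [simp]:
  "peval (grad_dot p F) x = pgrad p x \<bullet> (\<chi> j. peval (F j) x)"
  by (simp add: grad_dot_def pgrad_def inner_vec_def)

lemma continuous_on_pgrad [continuous_intros]:
  "continuous_on S h \<Longrightarrow> continuous_on S (\<lambda>t. pgrad p (h t))"
  unfolding pgrad_def by (intro continuous_intros)

lemma peval_has_derivative: "(peval p has_derivative (\<lambda>h. pgrad p x \<bullet> h)) (at x)"
proof -
  let ?e = "\<lambda>a j. Poly_Mapping.lookup a j"
  \<comment> \<open>Truncated subtraction occurs on both sides, so an exponent 0 at \<open>j\<close>
    needs no separate case; in the derivative such terms carry the factor 0.\<close>
  have *: "(\<Prod>k\<in>UNIV. (x $ k) ^ ?e (a - Poly_Mapping.single j 1) k)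
      = (x $ j) ^ (?e a j - 1) * (\<Prod>k\<in>UNIV - {j}. (x $ k) ^ ?e a k)" for a :: "'a \<Rightarrow>\<^sub>0 nat" and j
  proof -
    have "(\<Prod>k\<in>UNIV - {j}. (x $ k) ^ ?e (a - Poly_Mapping.single j 1) k) = (\<Prod>k\<in>UNIV - {j}. (x $ k) ^ ?e a k)"
      by (rule prod.cong) (auto simp: lookup_minus lookup_single when_def)
    then show ?thesis
      by (subst prod.remove[of _ j]) (auto simp: lookup_minus)
  qed
  have "(peval p has_derivative (\<lambda>h. \<Sum>a\<in>Poly_Mapping.keys p. Poly_Mapping.lookup p a *
      (\<Sum>j\<in>UNIV. real (?e a j) * (h $ j) * (x $ j) ^ (?e a j - 1) * (\<Prod>k\<in>UNIV - {j}. (x $ k) ^ ?e a k)))) (at x)"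
    unfolding peval_def[abs_def]
    by (intro has_derivative_sum has_derivative_mult_right has_derivative_prod has_derivative_power
        bounded_linear_imp_has_derivative bounded_linear_vec_nth)
  also have "(\<lambda>h. \<Sum>a\<in>Poly_Mapping.keys p. Poly_Mapping.lookup p a *
      (\<Sum>j\<in>UNIV. real (?e a j) * (h $ j) * (x $ j) ^ (?e a j - 1) * (\<Prod>k\<in>UNIV - {j}. (x $ k) ^ ?e a k)))
      = (\<lambda>h. pgrad p x \<bullet> h)"
  proof
    fix h :: "real^'a"
    have "pgrad p x \<bullet> h = (\<Sum>j\<in>UNIV. \<Sum>a\<in>Poly_Mapping.keys p.
        (real (?e a j) * Poly_Mapping.lookup p a * ((x $ j) ^ (?e a j - 1) * (\<Prod>k\<in>UNIV - {j}. (x $ k) ^ ?e a k))) * (h $ j))"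
      by (simp add: pgrad_def pdiff_def inner_vec_def peval_single * sum_distrib_right flip: One_nat_def)
    also have "\<dots> = (\<Sum>a\<in>Poly_Mapping.keys p. Poly_Mapping.lookup p a *
      (\<Sum>j\<in>UNIV. real (?e a j) * (h $ j) * (x $ j) ^ (?e a j - 1) * (\<Prod>k\<in>UNIV - {j}. (x $ k) ^ ?e a k)))"
      by (subst sum.swap) (simp add: sum_distrib_left mult_ac)
    finally show "(\<Sum>a\<in>Poly_Mapping.keys p. Poly_Mapping.lookup p a *
      (\<Sum>j\<in>UNIV. real (?e a j) * (h $ j) * (x $ j) ^ (?e a j - 1) * (\<Prod>k\<in>UNIV - {j}. (x $ k) ^ ?e a k)))
      = pgrad p x \<bullet> h" by simp
  qed
  finally show ?thesis .
qed

section \<open>Signs on the semialgebraic set: quadratic modules and the product of the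
  constraints\<close>

lemma peval_sos_nonneg: "s \<in> sos_le e \<Longrightarrow> 0 \<le> peval s x"
proof -
  have "0 \<le> peval (\<Sum>q\<leftarrow>qs. q\<^sup>2) x" for qs
    by (induction qs) (auto simp: power2_eq_square)
  then show "s \<in> sos_le e \<Longrightarrow> 0 \<le> peval s x"
    by (auto simp: sos_le_def)
qed

lemma peval_quad_module_nonneg:
  assumes "q \<in> quad_module ng g d" "x \<in> semialg_set ng g"
  shows "0 \<le> peval q x"
  using assms unfolding quad_module_def semialg_set_def
  by (auto intro!: add_nonneg_nonneg sum_nonneg mult_nonneg_nonneg elim!: peval_sos_nonneg
      simp del: atLeastAtMost_iff)

text \<open>If no factor vanishes at a point of the set, all of the finitely many constraints are
  strict there; by continuity they stay strict nearby, which makes the point interior.\<close>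

lemma boundary_peval_prod_eq_0:
  assumes "x \<in> semialg_set ng g" "x \<notin> interior (semialg_set ng g)"
  shows "peval (\<Prod>i=1..ng. g i) x = 0"
proof (rule ccontr)
  assume "peval (\<Prod>i=1..ng. g i) x \<noteq> 0"
  then have pos: "\<And>i. i \<in> {1..ng} \<Longrightarrow> 0 < peval (g i) x"
    using assms(1) by (fastforce simp: semialg_set_def order_less_le)
  let ?S = "\<Inter>i\<in>{1..ng}. {y. 0 < peval (g i) y}"
  have "open ?S"
    by (intro open_INT finite_atLeastAtMost ballI open_Collect_less continuous_intros)
  moreover have "x \<in> ?S" "?S \<subseteq> semialg_set ng g"
    using pos by (auto simp: semialg_set_def order_less_imp_le)
  ultimately show False
    using assms(2) interiorI by metis
qed

section \<open>A chain rule for indefinite integrals\<close>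

text \<open>Since \<open>R z - R (x t)\<close> is of smaller order than \<open>z - x t\<close>, and
  \<open>x s - x t\<close> is at most \<open>K\<close> times \<open>s - t\<close> in norm, the
  composite increment is of smaller order than \<open>s - t\<close>. The curve \<open>x\<close>
  itself may fail to be differentiable at \<open>t\<close>.\<close>

lemma has_vector_derivative_zero_lipschitz_compose:
  fixes x :: "real \<Rightarrow> 'a::real_normed_vector" and R :: "'a \<Rightarrow> real"
  assumes R: "(R has_derivative (\<lambda>h. 0)) (at (x t))"
    and x: "K-lipschitz_on S x" and t: "t \<in> S"
  shows "((\<lambda>s. R (x s)) has_vector_derivative 0) (at t within S)"
  unfolding has_vector_derivative_def has_derivative_within_alt
proof (intro conjI allI impI)
  show "bounded_linear (\<lambda>h. h *\<^sub>R (0 :: real))"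
    by (rule bounded_linear_scaleR_left)
next
  fix e :: real assume "0 < e"
  have K: "0 \<le> K"
    using x by (rule lipschitz_on_nonneg)
  \<comment> \<open>Dividing by \<open>K + 1\<close> rather than \<open>K\<close> covers the case
    \<open>K = 0\<close>.\<close>
  have "0 < e / (K + 1)"
    using \<open>0 < e\<close> K by simp
  then obtain d where d: "0 < d"
    "\<And>z. norm (z - x t) < d \<Longrightarrow> norm (R z - R (x t)) \<le> e / (K + 1) * norm (z - x t)"
    using R unfolding has_derivative_at_alt by fastforce
  show "\<exists>d>0. \<forall>s\<in>S. norm (s - t) < d \<longrightarrow>
      norm (R (x s) - R (x t) - (s - t) *\<^sub>R 0) \<le> e * norm (s - t)"
  proof (intro exI[of _ "d / (K + 1)"] conjI ballI impI)
    show "0 < d / (K + 1)"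
      using d K by simp
    fix s assume s: "s \<in> S" "norm (s - t) < d / (K + 1)"
    have "norm (x s - x t) \<le> K * norm (s - t)"
      using lipschitz_onD[OF x s(1) t] by (simp add: dist_norm)
    also have "\<dots> \<le> (K + 1) * norm (s - t)"
      by (simp add: distrib_right)
    finally have le: "norm (x s - x t) \<le> (K + 1) * norm (s - t)" .
    also have "\<dots> < d"
      using s(2) K by (simp add: field_simps)
    finally have "norm (R (x s) - R (x t)) \<le> e / (K + 1) * norm (x s - x t)"
      by (rule d(2))
    also have "\<dots> \<le> e / (K + 1) * ((K + 1) * norm (s - t))"
      using le \<open>0 < e / (K + 1)\<close> by (intro mult_left_mono) auto
    also have "\<dots> = e * norm (s - t)"
      using K by simp
    finally show "norm (R (x s) - R (x t) - (s - t) *\<^sub>R 0) \<le> e * norm (s - t)"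
      by simp
  qed
qed

text \<open>The increment of \<open>x\<close> over \<open>{s..t}\<close> is the integral of
  \<open>y\<close> there, hence at most \<open>K * (t - s)\<close> in norm. The set \<open>S\<close>
  stands for a bounded or unbounded horizon.\<close>

lemma lipschitz_on_indefinite_integral:
  fixes x y :: "real \<Rightarrow> 'a::euclidean_space"
  assumes S: "\<And>t. t \<in> S \<Longrightarrow> 0 \<le> t \<and> {0..t} \<subseteq> S"
    and bound: "\<And>s. s \<in> S \<Longrightarrow> norm (y s) \<le> K" and K: "0 \<le> K"
    and x: "\<And>t. t \<in> S \<Longrightarrow> (y has_integral (x t - x 0)) {0..t}"
  shows "K-lipschitz_on S x"
proof (rule lipschitz_on_leI[OF _ K])
  fix s t assume st: "s \<in> S" "t \<in> S" "s \<le> t"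
  then have "0 \<le> s" "{0..t} \<subseteq> S"
    using S by auto
  have "y integrable_on {0..t}"
    using x[OF st(2)] by (rule has_integral_integrable)
  then have "y integrable_on {s..t}"
    by (rule integrable_on_subinterval) (use \<open>0 \<le> s\<close> in auto)
  then obtain i where i: "(y has_integral i) {s..t}"
    unfolding integrable_on_def by blast
  have "(y has_integral (x s - x 0 + i)) {0..t}"
    using has_integral_combine[OF \<open>0 \<le> s\<close> st(3) x[OF st(1)] i] .
  then have "x s - x 0 + i = x t - x 0"
    using x[OF st(2)] by (rule has_integral_unique)
  then have "i = x t - x s"
    by (simp add: algebra_simps)
  moreover have "norm (y r) \<le> K" if "r \<in> {s..t}" for r
    by (intro bound subsetD[OF \<open>{0..t} \<subseteq> S\<close>]) (use that \<open>0 \<le> s\<close> in auto)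
  then have "norm i \<le> K * Henstock_Kurzweil_Integration.content {s..t}"
    using has_integral_bound_real[OF K _ i, of "{}"] by auto
  ultimately show "dist (x s) (x t) \<le> K * dist s t"
    using st by (simp add: dist_norm norm_minus_commute)
qed

text \<open>A general Euclidean space is allowed so that the rule covers the curve
  \<open>(x t, t)\<close> in space-time, through which the discount factor enters.\<close>

lemma chain_rule_indefinite_integral:
  fixes x y :: "real \<Rightarrow> 'a::euclidean_space" and W :: "'a \<Rightarrow> real"
  assumes T: "0 \<le> T"
    and meas: "y \<in> borel_measurable (lebesgue_on {0..T})"
    and bound: "\<And>s. s \<in> {0..T} \<Longrightarrow> norm (y s) \<le> K"
    and x: "\<And>t. t \<in> {0..T} \<Longrightarrow> (y has_integral (x t - x 0)) {0..t}"
    and der: "\<And>z. (W has_derivative (\<lambda>h. G z \<bullet> h)) (at z)"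
    and cont: "continuous_on UNIV G"
  shows "((\<lambda>s. G (x s) \<bullet> y s) has_integral (W (x T) - W (x 0))) {0..T}"
proof -
  have K: "0 \<le> K"
    using order_trans[OF norm_ge_zero bound[of 0]] T by simp
  have lip: "K-lipschitz_on {0..T} x"
    by (rule lipschitz_on_indefinite_integral[OF _ bound K x]) auto
  have Gx: "continuous_on {0..T} (\<lambda>s. G (x s))"
    using continuous_on_compose2[OF cont lipschitz_on_continuous_on[OF lip]] by auto
  then have "bounded ((\<lambda>s. G (x s)) ` {0..T})"
    by (intro compact_imp_bounded compact_continuous_image) auto
  then obtain C where C: "\<And>s. s \<in> {0..T} \<Longrightarrow> norm (G (x s)) \<le> C"
    unfolding bounded_iff by blast
  define I where "I = (\<lambda>s. G (x s) \<bullet> y s)"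
  have "I absolutely_integrable_on {0..T}"
  proof (rule measurable_bounded_by_integrable_imp_absolutely_integrable[where g = "\<lambda>_. C * K"])
    have "(\<lambda>s. G (x s)) \<in> borel_measurable (lebesgue_on {0..T})"
      by (rule continuous_imp_measurable_on_sets_lebesgue[OF Gx]) simp
    then show "I \<in> borel_measurable (lebesgue_on {0..T})"
      unfolding I_def using meas by (rule borel_measurable_inner)
    fix s assume s: "s \<in> {0..T}"
    have "norm (I s) \<le> norm (G (x s)) * norm (y s)"
      unfolding I_def by (simp add: Cauchy_Schwarz_ineq2)
    also have "\<dots> \<le> C * K"
      using C[OF s] bound[OF s] by (intro mult_mono) (auto intro: order_trans[OF norm_ge_zero])
    finally show "norm (I s) \<le> C * K" .
  qed auto
  then have I: "I integrable_on {0..T}"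
    by (rule set_lebesgue_integral_eq_integral)
  define \<Phi> where "\<Phi> t = W (x t) - integral {0..t} I" for t
  have "(\<Phi> has_vector_derivative 0) (at t within {0..T})" if t: "t \<in> {0..T}" for t
  proof -
    \<comment> \<open>Freezing the gradient at \<open>x t\<close> writes the integral of
      \<open>I\<close> as an explicit part, \<open>G (x t)\<close> applied to the displacement,
      minus the integral of the error \<open>h\<close>.\<close>
    define h where "h s = G (x t) \<bullet> y s - I s" for s
    have y: "(\<lambda>s. G (x t) \<bullet> y s) integrable_on {0..r}"
      and y': "integral {0..r} (\<lambda>s. G (x t) \<bullet> y s) = G (x t) \<bullet> (x r - x 0)" if "r \<in> {0..T}" for r
      using has_integral_linear[OF x[OF that] bounded_linear_inner_right[of "G (x t)"]]
      by (simp_all add: o_def has_integral_iff)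
    have I': "I integrable_on {0..r}" if "r \<in> {0..T}" for r
      using I by (rule integrable_on_subinterval) (use that in auto)
    have "h integrable_on {0..T}"
      unfolding h_def using T by (intro integrable_diff y I) auto
    moreover have "continuous (at t within {0..T}) h"
    proof -
      have "((\<lambda>s. G (x s)) \<longlongrightarrow> G (x t)) (at t within {0..T})"
        using Gx t unfolding continuous_on_def by blast
      then have "((\<lambda>s. norm (G (x t) - G (x s)) * K) \<longlongrightarrow> norm (G (x t) - G (x t)) * K) (at t within {0..T})"
        by (intro tendsto_intros)
      moreover have "\<forall>\<^sub>F s in at t within {0..T}. norm (h s) \<le> norm (G (x t) - G (x s)) * K"
        unfolding eventually_at_filter
      proof (intro always_eventually allI impI)
        fix s assume "s \<in> {0..T}"
        have "norm (h s) \<le> norm (G (x t) - G (x s)) * norm (y s)"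
          unfolding h_def I_def inner_diff_left[symmetric] by (simp add: Cauchy_Schwarz_ineq2)
        also have "\<dots> \<le> norm (G (x t) - G (x s)) * K"
          using bound[OF \<open>s \<in> {0..T}\<close>] by (intro mult_left_mono) auto
        finally show "norm (h s) \<le> norm (G (x t) - G (x s)) * K" .
      qed
      ultimately have "(h \<longlongrightarrow> 0) (at t within {0..T})"
        using Lim_null_comparison[of h "\<lambda>s. norm (G (x t) - G (x s)) * K"] by simp
      then show ?thesis
        by (simp add: continuous_within h_def I_def)
    qed
    ultimately have "((\<lambda>r. integral {0..r} h) has_vector_derivative h t) (at t within {0..T})"
      using integral_has_vector_derivative_continuous_at[of h 0 T t "{}"] t by simp
    then have dh: "((\<lambda>r. integral {0..r} h) has_vector_derivative 0) (at t within {0..T})"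
      by (simp add: h_def I_def)
    \<comment> \<open>Subtracting the linear part of \<open>W\<close> at \<open>x t\<close> leaves a
      function with derivative zero there, so composition with the Lipschitz curve has derivative
      zero as well.\<close>
    have "((\<lambda>z. W z - G (x t) \<bullet> z) has_derivative (\<lambda>h. 0)) (at (x t))"
      using has_derivative_diff[OF der[of "x t"]
          bounded_linear_imp_has_derivative[OF bounded_linear_inner_right[of "G (x t)"]]] by simp
    from has_vector_derivative_zero_lipschitz_compose[OF this lip t]
    have dW: "((\<lambda>r. W (x r) - G (x t) \<bullet> x r) has_vector_derivative 0) (at t within {0..T})" .
    have "((\<lambda>r. W (x r) - G (x t) \<bullet> x r + integral {0..r} h + G (x t) \<bullet> x 0)
        has_vector_derivative (0 + 0 + 0)) (at t within {0..T})"
      by (intro has_vector_derivative_add dW dh has_vector_derivative_const)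
    then have d: "((\<lambda>r. W (x r) - G (x t) \<bullet> x r + integral {0..r} h + G (x t) \<bullet> x 0)
        has_vector_derivative 0) (at t within {0..T})"
      by (simp only: add_0)
    have "\<Phi> r = W (x r) - G (x t) \<bullet> x r + integral {0..r} h + G (x t) \<bullet> x 0" if r: "r \<in> {0..T}" for r
      unfolding \<Phi>_def h_def integral_diff[OF y[OF r] I'[OF r]] y'[OF r]
      by (simp add: inner_diff_right)
    from has_vector_derivative_transform[OF t this d] show ?thesis .
  qed
  then obtain c where "\<And>t. t \<in> {0..T} \<Longrightarrow> \<Phi> t = c"
    using has_vector_derivative_zero_constant[of "{0..T}" \<Phi>] convex_real_interval by metis
  then have "\<Phi> T = \<Phi> 0"
    using T by simp
  then have "integral {0..T} I = W (x T) - W (x 0)"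
    by (simp add: \<Phi>_def)
  with I have "(I has_integral (W (x T) - W (x 0))) {0..T}"
    by (simp add: has_integral_iff)
  then show ?thesis
    by (simp add: I_def)
qed

section \<open>Bounds along admissible trajectories\<close>

lemma control_box_eq_cbox: "control_box ub = cbox 0 (\<chi> i. ub)"
  by (auto simp: control_box_def mem_box_cart)

lemma continuous_on_dynamics:
  "continuous_on S (\<lambda>z. dynamics f fu (fst z) (snd z))"
  unfolding dynamics_def by (intro continuous_intros)

lemma continuous_on_stage_cost:
  "continuous_on S (\<lambda>z. stage_cost lx lu (fst z) (snd z))"
  unfolding stage_cost_def by (intro continuous_intros)

lemma bounded_dynamics:
  assumes "compact X" "compact U"
  obtains K where "0 \<le> K" "\<And>x u. x \<in> X \<Longrightarrow> u \<in> U \<Longrightarrow> norm (dynamics f fu x u) \<le> K"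
proof -
  have "bounded ((\<lambda>z. dynamics f fu (fst z) (snd z)) ` (X \<times> U))"
    using assms by (intro compact_imp_bounded compact_continuous_image compact_Times continuous_on_dynamics)
  then obtain b where "0 < b" "\<forall>v\<in>(\<lambda>z. dynamics f fu (fst z) (snd z)) ` (X \<times> U). norm v \<le> b"
    unfolding bounded_pos by blast
  then show thesis
    by (intro that[of b]) auto
qed

lemma bounded_stage_cost:
  assumes "compact X" "compact U"
  obtains C where "\<And>x u. x \<in> X \<Longrightarrow> u \<in> U \<Longrightarrow> norm (stage_cost lx lu x u) \<le> C"
proof -
  have "bounded ((\<lambda>z. stage_cost lx lu (fst z) (snd z)) ` (X \<times> U))"
    using assms by (intro compact_imp_bounded compact_continuous_image compact_Times continuous_on_stage_cost)
  then obtain b where "\<forall>v\<in>(\<lambda>z. stage_cost lx lu (fst z) (snd z)) ` (X \<times> U). norm v \<le> b"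
    unfolding bounded_iff by blast
  then show thesis
    by (intro that[of b]) auto
qed

text \<open>The state and time derivatives are packed into one pair, giving the inner product form
  that the chain rule expects.\<close>

lemma discounted_peval_has_derivative:
  "((\<lambda>z. exp (- \<beta> * snd z) * peval V (fst z)) has_derivative
     (\<lambda>h. (exp (- \<beta> * snd z) *\<^sub>R pgrad V (fst z), - \<beta> * exp (- \<beta> * snd z) * peval V (fst z)) \<bullet> h)) (at z)"
proof -
  have V: "((\<lambda>z. peval V (fst z)) has_derivative (\<lambda>h. pgrad V (fst z) \<bullet> fst h)) (at z)"
    by (rule has_derivative_compose[OF has_derivative_fst[OF has_derivative_ident] peval_has_derivative])
  have "((\<lambda>z :: _ \<times> real. - \<beta> * snd z) has_derivative (\<lambda>h. - \<beta> * snd h)) (at z)"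
    by (intro has_derivative_mult_right has_derivative_snd has_derivative_ident)
  then have E: "((\<lambda>z. exp (- \<beta> * snd z)) has_derivative (\<lambda>h. exp (- \<beta> * snd z) * (- \<beta> * snd h))) (at z)"
    by (rule has_derivative_exp[THEN has_derivative_eq_rhs]) (simp add: mult_ac)
  show ?thesis
    by (rule has_derivative_mult[OF E V, THEN has_derivative_eq_rhs]) (auto simp: inner_prod_def algebra_simps)
qed

text \<open>Turns the almost everywhere constraint in \<open>controls\<close> into a negligible set,
  the form in which gauge integrals can ignore it.\<close>

lemma negligible_control_exception:
  assumes "u \<in> controls U S" "S \<in> sets lebesgue"
  shows "negligible {t \<in> S. u t \<notin> U}"
proof -
  have "AE t in lebesgue. t \<in> S \<longrightarrow> u t \<in> U"
    using assms by (simp add: controls_def AE_restrict_space_iff)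
  then obtain N where "N \<in> null_sets lebesgue" "{t. \<not> (t \<in> S \<longrightarrow> u t \<in> U)} \<subseteq> N"
    by (auto simp: eventually_ae_filter)
  then show ?thesis
    using negligible_subset[of N "{t \<in> S. u t \<notin> U}"] by (auto simp: negligible_iff_null_sets)
qed

text \<open>The formal time derivative of \<open>exp (- \<beta> * t) * peval V (x t)\<close> plus
  the discounted running cost is \<open>exp (- \<beta> * t)\<close> times the expression in
  \<open>diss\<close>, hence nonnegative; this is integrated over \<open>{0..T}\<close>. As
  \<open>stage_cost\<close> is nonnegative, enlarging the cost integral to \<open>S\<close> keeps
  the inequality. The time \<open>T\<close> stays free so that it can be the stopping time or tend
  to infinity.\<close>

lemma value_bound_along_trajectory:
  fixes f :: "'n::finite \<Rightarrow> 'n rpoly" and fu :: "'m::finite \<Rightarrow> 'n \<Rightarrow> 'n rpoly"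
  assumes S: "\<And>t. t \<in> S \<Longrightarrow> 0 \<le> t \<and> {0..t} \<subseteq> S" and S_sets: "S \<in> sets lebesgue"
    and exp_S: "(\<lambda>t. exp (- \<beta> * t)) integrable_on S"
    and X: "compact X" and U: "compact U" and u0: "u0 \<in> U"
    and u: "u \<in> controls U S" and sol: "solution f fu x0 S u x" and x_X: "\<And>t. t \<in> S \<Longrightarrow> x t \<in> X"
    and nonneg: "\<And>y w. y \<in> X \<Longrightarrow> w \<in> U \<Longrightarrow> 0 \<le> stage_cost lx lu y w"
    and diss: "\<And>y w. y \<in> X \<Longrightarrow> w \<in> U \<Longrightarrow>
      0 \<le> stage_cost lx lu y w - \<beta> * peval V y + pgrad V y \<bullet> dynamics f fu y w"
    and T: "T \<in> S"
  shows "peval V x0 \<le> (LINT t:S|lebesgue. exp (- \<beta> * t) * stage_cost lx lu (x t) (u t))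
      + exp (- \<beta> * T) * peval V (x T)"
proof -
  define N where "N = {t \<in> S. u t \<notin> U}"
  have N: "negligible N"
    unfolding N_def using u S_sets by (rule negligible_control_exception)
  \<comment> \<open>Changing the control on a null set makes all bounds hold everywhere instead of almost everywhere.\<close>
  define w where "w t = (if u t \<in> U then u t else u0)" for t
  have w_U: "w t \<in> U" for t
    using u0 by (simp add: w_def)
  have w_eq: "w t = u t" if "t \<in> S - N" for t
    using that by (auto simp: w_def N_def)
  have [measurable]: "U \<in> sets borel"
    using U by (intro borel_closed compact_imp_closed)
  have [measurable]: "u \<in> borel_measurable (lebesgue_on S)"
    using u by (simp add: controls_def)
  have w_meas: "w \<in> borel_measurable (lebesgue_on S)"
    unfolding w_def by measurable
  define y where "y t = dynamics f fu (x t) (w t)" for t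
  obtain K where K: "0 \<le> K" "\<And>x u. x \<in> X \<Longrightarrow> u \<in> U \<Longrightarrow> norm (dynamics f fu x u) \<le> K"
    using bounded_dynamics[OF X U] by blast
  have y_bound: "norm (y t) \<le> K" if "t \<in> S" for t
    unfolding y_def using K(2) x_X[OF that] w_U by blast
  have T0: "0 \<le> T" "{0..T} \<subseteq> S"
    using S[OF T] by auto
  then have "0 \<in> S"
    by auto
  \<comment> \<open>Passes from the Lebesgue integrals in \<open>solution\<close> to gauge
    integrals, and from \<open>u\<close> to \<open>w\<close>, which differ within \<open>S\<close>
    only on \<open>N\<close>.\<close>
  have x_int0: "(y has_integral (x t - x0)) {0..t}" if t: "t \<in> S" for t
  proof (rule has_integral_spike[OF N])
    show "y s = dynamics f fu (x s) (u s)" if "s \<in> {0..t} - N" for s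
      using that S[OF t] w_eq[of s] by (auto simp: y_def)
    show "((\<lambda>s. dynamics f fu (x s) (u s)) has_integral (x t - x0)) {0..t}"
      using sol t set_lebesgue_integral_eq_integral[of "{0..t}" "\<lambda>s. dynamics f fu (x s) (u s)"]
      by (simp add: solution_def has_integral_iff)
  qed
  \<comment> \<open>At time 0 the integral equation has a degenerate interval, which yields the
    initial condition.\<close>
  have "(y has_integral 0) {0..0}"
    using has_integral_refl(2)[of y 0] by simp
  from has_integral_unique[OF x_int0[OF \<open>0 \<in> S\<close>] this] have x_0: "x 0 = x0"
    by simp
  note x_int = x_int0[folded x_0]
  have x_cont: "continuous_on S x"
    using lipschitz_on_indefinite_integral[OF S y_bound K(1) x_int] by (rule lipschitz_on_continuous_on)
  then have x_meas: "x \<in> borel_measurable (lebesgue_on S)"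
    using S_sets by (rule continuous_imp_measurable_on_sets_lebesgue)
  have y_meas: "y \<in> borel_measurable (lebesgue_on S)"
    unfolding y_def by (rule borel_measurable_continuous_Pair[OF x_meas w_meas continuous_on_dynamics])
  define c where "c t = exp (- \<beta> * t) * stage_cost lx lu (x t) (w t)" for t
  have c_nonneg: "0 \<le> c t" if "t \<in> S" for t
    unfolding c_def using nonneg x_X[OF that] w_U by simp
  obtain C where C: "\<And>x u. x \<in> X \<Longrightarrow> u \<in> U \<Longrightarrow> norm (stage_cost lx lu x u) \<le> C"
    using bounded_stage_cost[OF X U] by blast
  \<comment> \<open>The discount times a bound for \<open>stage_cost\<close> dominates
    \<open>c\<close>; by \<open>exp_S\<close> this works on an infinite horizon too. Integrability
    matters because a non-integrable function would get the default Lebesgue integral 0.\<close>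
  have c_ai: "c absolutely_integrable_on S"
  proof (rule measurable_bounded_by_integrable_imp_absolutely_integrable[OF _ S_sets])
    have e: "(\<lambda>t. exp (- \<beta> * t)) \<in> borel_measurable (lebesgue_on S)"
      by (rule continuous_imp_measurable_on_sets_lebesgue[OF _ S_sets]) (intro continuous_intros)
    show "c \<in> borel_measurable (lebesgue_on S)"
      unfolding c_def
      by (rule borel_measurable_times[OF e
          borel_measurable_continuous_Pair[OF x_meas w_meas continuous_on_stage_cost]])
    show "(\<lambda>t. exp (- \<beta> * t) * C) integrable_on S"
      using exp_S by (rule integrable_on_mult_left)
    show "norm (c t) \<le> exp (- \<beta> * t) * C" if "t \<in> S" for t
      using C[OF x_X[OF that] w_U, of t] by (simp add: c_def abs_mult mult_left_mono)
  qed
  then have c_int: "c integrable_on S"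
    by (rule set_lebesgue_integral_eq_integral)
  have cost_eq: "exp (- \<beta> * t) * stage_cost lx lu (x t) (u t) = c t" if "t \<in> S - N" for t
    using w_eq[OF that] by (simp add: c_def)
  have "(\<lambda>t. exp (- \<beta> * t) * stage_cost lx lu (x t) (u t)) absolutely_integrable_on S"
    using c_ai N cost_eq by (rule absolutely_integrable_spike)
  then have "(LINT t:S|lebesgue. exp (- \<beta> * t) * stage_cost lx lu (x t) (u t))
      = integral S (\<lambda>t. exp (- \<beta> * t) * stage_cost lx lu (x t) (u t))"
    by (rule set_lebesgue_integral_eq_integral)
  also have "\<dots> = integral S c"
    using N cost_eq[symmetric] by (rule integral_spike)
  finally have cost: "(LINT t:S|lebesgue. exp (- \<beta> * t) * stage_cost lx lu (x t) (u t)) = integral S c" .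
  let ?G = "\<lambda>z. (exp (- \<beta> * snd z) *\<^sub>R pgrad V (fst z), - \<beta> * exp (- \<beta> * snd z) * peval V (fst z))"
  let ?W = "\<lambda>z. exp (- \<beta> * snd z) * peval V (fst z)"
  have "((\<lambda>t. ?G (x t, t) \<bullet> (y t, 1)) has_integral (?W (x T, T) - ?W (x 0, 0))) {0..T}"
  \<comment> \<open>The time component of the space-time velocity \<open>(y t, 1)\<close> accounts
    for the added 1 in \<open>K + 1\<close>.\<close>
  proof (rule chain_rule_indefinite_integral[OF T0(1), where K = "K + 1" and x = "\<lambda>t. (x t, t)"])
    have "y \<in> borel_measurable (lebesgue_on {0..T})"
      using y_meas T0(2) by (rule measurable_restrict_mono)
    then show "(\<lambda>t. (y t, 1 :: real)) \<in> borel_measurable (lebesgue_on {0..T})"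
      by measurable
    show "norm (y t, 1 :: real) \<le> K + 1" if "t \<in> {0..T}" for t
      using norm_Pair_le[of "y t" "1 :: real"] y_bound[of t] that T0(2) by auto
    show "((\<lambda>s. (y s, 1 :: real)) has_integral ((x t, t) - (x 0, 0))) {0..t}" if "t \<in> {0..T}" for t
    proof -
      have t: "t \<in> S" "0 \<le> t"
        using that T0(2) by auto
      have "((\<lambda>s. (y s, 0 :: real)) has_integral (x t - x 0, 0)) {0..t}"
        using has_integral_linear[OF x_int[OF t(1)] bounded_linear_Pair[OF bounded_linear_ident bounded_linear_zero]]
        by (simp add: o_def)
      moreover have "((\<lambda>s. 1 :: real) has_integral t) {0..t}"
        using has_integral_const_real[of "1::real" 0 t] t(2) by simp
      from has_integral_linear[OF this bounded_linear_Pair[OF bounded_linear_zero bounded_linear_ident]]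
      have "((\<lambda>s. (0 :: real^'n, 1 :: real)) has_integral (0, t)) {0..t}"
        by (simp add: o_def)
      ultimately have "((\<lambda>s. (y s, 0) + (0, 1 :: real)) has_integral ((x t - x 0, 0) + (0, t))) {0..t}"
        by (rule has_integral_add)
      then show ?thesis
        by simp
    qed
    show "(?W has_derivative (\<lambda>h. ?G z \<bullet> h)) (at z)" for z
      by (rule discounted_peval_has_derivative)
    show "continuous_on UNIV ?G"
      by (intro continuous_intros)
  qed
  then have W: "((\<lambda>t. ?G (x t, t) \<bullet> (y t, 1)) has_integral (exp (- \<beta> * T) * peval V (x T) - peval V x0)) {0..T}"
    by (simp add: x_0)
  have c_T: "c integrable_on {0..T}"
    using c_ai T0(2) set_integrable_subset[of lebesgue S c "{0..T}"] by (auto intro: set_lebesgue_integral_eq_integral)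
  have "0 \<le> exp (- \<beta> * T) * peval V (x T) - peval V x0 + integral {0..T} c"
  proof (rule has_integral_nonneg[OF has_integral_add[OF W integrable_integral[OF c_T]]])
    fix t assume "t \<in> {0..T}"
    then have "t \<in> S"
      using T0(2) by auto
    have "?G (x t, t) \<bullet> (y t, 1) + c t
        = exp (- \<beta> * t) * (stage_cost lx lu (x t) (w t) - \<beta> * peval V (x t) + pgrad V (x t) \<bullet> dynamics f fu (x t) (w t))"
      by (simp add: inner_prod_def c_def y_def algebra_simps)
    then show "0 \<le> ?G (x t, t) \<bullet> (y t, 1) + c t"
      using diss[OF x_X[OF \<open>t \<in> S\<close>] w_U, of t] by simp
  qed
  moreover have "integral {0..T} c \<le> integral S c"
    by (rule integral_subset_le[OF T0(2) c_T c_int]) (intro ballI c_nonneg)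
  ultimately show ?thesis
    unfolding cost by linarith
qed

text \<open>The comparison is made at a maximizer over \<open>X\<close>: on the boundary it is
  \<open>boundary\<close>, in the interior the gradient vanishes and \<open>stationary\<close> gives
  it after cancelling \<open>\<beta>\<close>.\<close>

lemma peval_le_of_maximum_principle:
  assumes X: "compact X" "x \<in> X" and beta: "0 < \<beta>"
    and stationary: "\<And>y. y \<in> interior X \<Longrightarrow> pgrad V y = 0 \<Longrightarrow> \<beta> * peval V y \<le> \<beta> * M"
    and boundary: "\<And>y. y \<in> X \<Longrightarrow> y \<notin> interior X \<Longrightarrow> peval V y \<le> M"
  shows "peval V x \<le> M"
proof -
  obtain y where y: "y \<in> X" "\<And>z. z \<in> X \<Longrightarrow> peval V z \<le> peval V y"
    using continuous_attains_sup[OF X(1) _ continuous_on_peval[OF continuous_on_id]] X(2) by blast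
  have "peval V y \<le> M"
  proof (cases "y \<in> interior X")
    case True
    have "(\<lambda>h. pgrad V y \<bullet> h) = (\<lambda>h. 0)"
      by (rule differential_zero_maxmin[OF True open_interior peval_has_derivative])
        (use y(2) interior_subset in blast)
    then have "pgrad V y = 0"
      by (metis inner_eq_zero_iff)
    then show ?thesis
      using stationary[OF True] beta by simp
  qed (use boundary y(1) in blast)
  then show ?thesis
    using y(2)[OF X(2)] by linarith
qed

lemma horizon_top [simp]: "horizon \<infinity> = {0..}"
  by (auto simp: horizon_def)

lemma horizon_ennreal [simp]: "0 \<le> r \<Longrightarrow> horizon (ennreal r) = {0..r}"
  by (auto simp: horizon_def)

text \<open>Applying \<open>V_le\<close> at \<open>x T\<close> leaves the terminal term
  \<open>exp (- \<beta> * T) * M\<close>. A finite stopping time is taken as \<open>T\<close>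
  itself; for an infinite one \<open>T\<close> tends to infinity.\<close>

lemma value_le_total_cost:
  fixes f :: "'n::finite \<Rightarrow> 'n rpoly" and fu :: "'m::finite \<Rightarrow> 'n \<Rightarrow> 'n rpoly"
  assumes beta: "0 < \<beta>" and X: "compact X" and U: "compact U" and u0: "u0 \<in> U"
    and nonneg: "\<And>y w. y \<in> X \<Longrightarrow> w \<in> U \<Longrightarrow> 0 \<le> stage_cost lx lu y w"
    and diss: "\<And>y w. y \<in> X \<Longrightarrow> w \<in> U \<Longrightarrow>
      0 \<le> stage_cost lx lu y w - \<beta> * peval V y + pgrad V y \<bullet> dynamics f fu y w"
    and V_le: "\<And>y. y \<in> X \<Longrightarrow> peval V y \<le> M"
    and adm: "admissible f fu X U x0 \<tau> u x"
  shows "peval V x0 \<le> total_cost lx lu \<beta> M (\<tau> x0) u x"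
proof -
  have u: "u \<in> controls U (horizon (\<tau> x0))" and sol: "solution f fu x0 (horizon (\<tau> x0)) u x"
    and x_X: "\<And>t. t \<in> horizon (\<tau> x0) \<Longrightarrow> x t \<in> X"
    using adm by (auto simp: admissible_def)
  let ?J = "LINT t:horizon (\<tau> x0)|lebesgue. exp (- \<beta> * t) * stage_cost lx lu (x t) (u t)"
  have S: "0 \<le> t \<and> {0..t} \<subseteq> horizon (\<tau> x0)" if "t \<in> horizon (\<tau> x0)" for t
    using that by (auto simp: horizon_def intro: order_trans[OF ennreal_leI])
  have le: "peval V x0 \<le> ?J + exp (- \<beta> * T) * M"
    if T: "horizon (\<tau> x0) \<in> sets lebesgue" "(\<lambda>t. exp (- \<beta> * t)) integrable_on horizon (\<tau> x0)"
      "T \<in> horizon (\<tau> x0)" for T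
  proof -
    have "exp (- \<beta> * T) * peval V (x T) \<le> exp (- \<beta> * T) * M"
      by (intro mult_left_mono V_le x_X T(3)) simp
    with value_bound_along_trajectory[OF S T(1,2) X U u0 u sol x_X nonneg diss T(3)]
    show ?thesis
      by linarith
  qed
  show ?thesis
  proof (cases "\<tau> x0")
    case (real r)
    have "(\<lambda>t. exp (- \<beta> * t)) integrable_on {0..r}"
      by (intro integrable_continuous_real continuous_intros)
    then show ?thesis
      using le[of r] real by (simp add: total_cost_def discount_def)
  next
    case top
    then have hor: "horizon (\<tau> x0) = {0..}"
      using horizon_top by (simp add: infinity_ennreal_def)
    have "peval V x0 \<le> ?J + exp (- \<beta> * T) * M" if "0 \<le> T" for T
      using le[of T] that integrable_on_exp_minus_to_infinity[OF beta, of 0] by (simp add: hor)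
    \<comment> \<open>The limit is left as \<open>0 * M\<close>, the form that the product rule for
      limits produces; it agrees with the value 0 of \<open>discount\<close> at infinity.\<close>
    moreover have "((\<lambda>T. ?J + exp (- \<beta> * T) * M) \<longlongrightarrow> ?J + 0 * M) at_top"
    proof -
      have "filterlim (\<lambda>T. - \<beta> * T) at_bot at_top"
        using beta filterlim_tendsto_neg_mult_at_bot[OF tendsto_const, of "- \<beta>" "\<lambda>T. T" at_top]
        by (simp add: filterlim_ident)
      then show ?thesis
        by (intro tendsto_intros filterlim_compose[OF exp_at_bot])
    qed
    ultimately have "peval V x0 \<le> ?J + 0 * M"
      by (intro tendsto_lowerbound) (auto intro: eventually_at_top_linorderI[of 0])
    then show ?thesis
      using top by (simp add: total_cost_def discount_def)
  qed
qed

text \<open>Stopping at time 0 shows that the infimum in \<open>value_function\<close> runs over a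
  nonempty set; the horizon is \<open>{0}\<close>, on which all integrals vanish.\<close>

lemma admissible_immediate_stop:
  assumes "x0 \<in> X" "u0 \<in> U"
  shows "admissible f fu X U x0 (\<lambda>_. 0) (\<lambda>_. u0) (\<lambda>_. x0)"
proof -
  have "horizon 0 = {0}"
    by (auto simp: horizon_def)
  then show ?thesis
    using assms
    by (auto simp: admissible_def controls_def solution_def set_integrable_def set_lebesgue_integral_def)
qed

section \<open>From the certificates to the lower bound on the value function\<close>

theorem theorem6:
  fixes f :: "'n::finite \<Rightarrow> 'n rpoly"
    and fu :: "'m::finite \<Rightarrow> 'n \<Rightarrow> 'n rpoly"
    and ng :: nat and g :: "nat \<Rightarrow> 'n rpoly"
    and X :: "(real^'n) set" and U :: "(real^'m) set"
    and ub \<beta> M :: real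
    and gbar lx :: "'n rpoly" and lu :: "'m \<Rightarrow> 'n rpoly"
    and d :: int
    and V :: "'n rpoly" and p :: "'m \<Rightarrow> 'n rpoly"
  assumes X: "X = semialg_set ng g"
    and U: "U = control_box ub"
    and ub: "0 \<le> ub"
    and compact_X: "compact X"
    and ball: "\<exists>i\<in>{1..ng}. \<exists>N\<ge>0. \<forall>x. peval (g i) x = N - (norm x)\<^sup>2"
    and gbar: "gbar = (\<Prod>i=1..ng. g i)"
    and gbar_pos: "\<forall>x\<in>interior X. 0 < peval gbar x"
    and beta: "0 < \<beta>"
    and l_nonneg: "\<forall>x\<in>X. \<forall>u\<in>U. 0 \<le> stage_cost lx lu x u"
    and M: "M > inverse \<beta> * (SUP (x, u)\<in>X \<times> U. stage_cost lx lu x u)"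
    and d: "0 \<le> d"
    and V_deg: "V \<in> polys_le d"
    and p_deg: "\<forall>i. p i \<in> polys_le d"
    and c1: "lx - pconst \<beta> * V + grad_dot V f + pconst ub * (\<Sum>i\<in>UNIV. p i)
               \<in> quad_module ng g d"
    and c2: "\<forall>i. lu i + grad_dot V (fu i) - p i \<in> quad_module ng g d"
    and c3: "\<forall>i. - p i \<in> quad_module ng g d"
    and c4: "pconst M - V
               \<in> quad_module ng g d + gbar *o polys_le (d - int (total_deg gbar))"
  shows "\<forall>x\<in>X. peval V x \<le> value_function f fu X U lx lu \<beta> M x"
proof
  fix x0 assume x0: "x0 \<in> X"
  have X_nonneg: "0 \<le> peval q y" if "q \<in> quad_module ng g d" "y \<in> X" for q y
    using peval_quad_module_nonneg that X by blast
  have p_nonpos: "peval (p i) y \<le> 0" if "y \<in> X" for i y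
    using X_nonneg[OF c3[rule_format, of i] that] by simp
  have compact_U: "compact U"
    by (simp add: U control_box_eq_cbox)
  have zero_U: "0 \<in> U"
    using ub by (simp add: U control_box_def)

  \<comment> \<open>The expression is the one certified by \<open>c1\<close> plus, for each
    \<open>i\<close>, \<open>w $ i\<close> times that of \<open>c2\<close> and
    \<open>ub - w $ i\<close> times that of \<open>c3\<close>. The terms in \<open>p i\<close>
    cancel, and the weights are nonnegative because \<open>w\<close> lies in the box.\<close>
  have diss: "0 \<le> stage_cost lx lu y w - \<beta> * peval V y + pgrad V y \<bullet> dynamics f fu y w"
    if y: "y \<in> X" and w: "w \<in> U" for y w
  proof -
    define F where "F i = pgrad V y \<bullet> (\<chi> j. peval (fu i j) y)" for i
    define P where "P i = peval (p i) y" for i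
    have "dynamics f fu y w = (\<chi> j. peval (f j) y) + (\<Sum>i\<in>UNIV. w $ i *\<^sub>R (\<chi> j. peval (fu i j) y))"
      by (simp add: vec_eq_iff dynamics_def mult.commute)
    then have dyn: "pgrad V y \<bullet> dynamics f fu y w
        = pgrad V y \<bullet> (\<chi> j. peval (f j) y) + (\<Sum>i\<in>UNIV. w $ i * F i)"
      by (simp add: inner_add_right inner_sum_right F_def)
    have "0 \<le> peval lx y - \<beta> * peval V y + pgrad V y \<bullet> (\<chi> j. peval (f j) y) + ub * (\<Sum>i\<in>UNIV. P i)"
      using X_nonneg[OF c1 y] by (simp add: P_def)
    moreover have "0 \<le> (\<Sum>i\<in>UNIV. w $ i * (peval (lu i) y + F i - P i) + (ub - w $ i) * - P i)"
    proof (intro sum_nonneg add_nonneg_nonneg mult_nonneg_nonneg)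
      fix i
      show "0 \<le> w $ i" "0 \<le> ub - w $ i"
        using w by (simp_all add: U control_box_def)
      show "0 \<le> peval (lu i) y + F i - P i"
        using X_nonneg[OF c2[rule_format, of i] y] by (simp add: F_def P_def)
      show "0 \<le> - P i"
        using p_nonpos[OF y] by (simp add: P_def)
    qed
    moreover have "(\<Sum>i\<in>UNIV. w $ i * (peval (lu i) y + F i - P i) + (ub - w $ i) * - P i)
        = (\<Sum>i\<in>UNIV. peval (lu i) y * w $ i) + (\<Sum>i\<in>UNIV. w $ i * F i) - ub * (\<Sum>i\<in>UNIV. P i)"
      unfolding sum_distrib_left sum.distrib[symmetric] sum_subtractf[symmetric]
      by (rule sum.cong) (auto simp: algebra_simps)
    ultimately show ?thesis
      unfolding stage_cost_def dyn by linarith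
  qed

  have V_le: "peval V y \<le> M" if y: "y \<in> X" for y
  proof (rule peval_le_of_maximum_principle[OF compact_X y beta])
    fix z assume "z \<in> X" "z \<notin> interior X"
    then have "peval gbar z = 0"
      using boundary_peval_prod_eq_0 X gbar by blast
    \<comment> \<open>The cofactor \<open>r\<close> has no known sign, but its term vanishes where
      \<open>gbar\<close> does, which leaves only \<open>q\<close>.\<close>
    moreover obtain q r where "q \<in> quad_module ng g d" "pconst M - V = q + gbar * r"
      using c4 by (auto simp: set_plus_def elt_set_times_def)
    ultimately have "peval (pconst M - V) z = peval q z" "0 \<le> peval q z"
      using X_nonneg \<open>z \<in> X\<close> by simp_all
    then show "peval V z \<le> M"
      by simp
  next
    fix z assume "z \<in> interior X" and grad: "pgrad V z = 0"
    then have z: "z \<in> X"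
      using interior_subset by blast
    obtain C where C: "\<And>x u. x \<in> X \<Longrightarrow> u \<in> U \<Longrightarrow> norm (stage_cost lx lu x u) \<le> C"
      using bounded_stage_cost[OF compact_X compact_U] by blast
    \<comment> \<open>A supremum of reals bounds its elements only if the set is bounded above;
      compactness of \<open>X\<close> and \<open>U\<close> provides this.\<close>
    have "bdd_above ((\<lambda>(x, u). stage_cost lx lu x u) ` (X \<times> U))"
      using C by (intro bdd_aboveI[of _ C]) (force simp: abs_le_iff)
    \<comment> \<open>Control 0 reduces \<open>stage_cost\<close> to \<open>lx\<close>, which bounds
      \<open>\<beta> * peval V z\<close> through \<open>c1\<close> once the gradient is zero and the
      \<open>p i\<close> are nonpositive.\<close>
    then have "stage_cost lx lu z 0 \<le> (SUP (x, u)\<in>X \<times> U. stage_cost lx lu x u)"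
      using cSUP_upper[of "(z, 0)" "X \<times> U" "\<lambda>(x, u). stage_cost lx lu x u"] z zero_U by simp
    also have "\<dots> \<le> \<beta> * M"
      using M beta by (simp add: field_simps)
    finally have "peval lx z \<le> \<beta> * M"
      by (simp add: stage_cost_def)
    moreover have "0 \<le> peval lx z - \<beta> * peval V z + ub * (\<Sum>i\<in>UNIV. peval (p i) z)"
      using X_nonneg[OF c1 z] grad by simp
    moreover have "ub * (\<Sum>i\<in>UNIV. peval (p i) z) \<le> 0"
      using ub p_nonpos[OF z] by (intro mult_nonneg_nonpos sum_nonpos) auto
    ultimately show "\<beta> * peval V z \<le> \<beta> * M"
      by linarith
  qed

  show "peval V x0 \<le> value_function f fu X U lx lu \<beta> M x0"
    unfolding value_function_def
  proof (rule cInf_greatest)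
    show "{total_cost lx lu \<beta> M (\<tau> x0) u x |\<tau> u x. admissible f fu X U x0 \<tau> u x} \<noteq> {}"
      using admissible_immediate_stop[OF x0 zero_U] by blast
  next
    fix J assume "J \<in> {total_cost lx lu \<beta> M (\<tau> x0) u x |\<tau> u x. admissible f fu X U x0 \<tau> u x}"
    then obtain \<tau> u x where "J = total_cost lx lu \<beta> M (\<tau> x0) u x" "admissible f fu X U x0 \<tau> u x"
      by blast
    then show "peval V x0 \<le> J"
      using value_le_total_cost[OF beta compact_X compact_U zero_U _ diss V_le] l_nonneg by blast
  qed
qed

end
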